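(* Let $\alpha\in(0,2]$ and $\sigma\ge 0$. Suppose $(\xi_{k,j})_{k,j\in\mathbb{N}}$ is an i.i.d. array of random variables whose common law is in the domain of normal attraction of $\mathcal{S}_\alpha$, and $(u^{(j)})_{j\in\mathbb{N}}$ is a sequence of real vectors $u^{(j)}=(u^{(j)}_k)_{k\in\mathbb{N}}\in\ell^\alpha$. If 1. $\lim_{j\to\infty}\|u^{(j)}\|_{\ell^\alpha}=\sigma$, and 2. $\lim_{j\to\infty}\|u^{(j)}\|_{\ell^\infty}=0$, then for each $j\in\mathbb{N}$ the series $\sum_{k\in\mathbb{N}}u^{(j)}_k\xi_{k,j}$ converges almost surely, and $$\sum_{k\in\mathbb{N}}u^{(j)}_k\xi_{k,j}\Longrightarrow\mathcal{S}_\alpha(\sigma)\quad\text{(in distribution) as } j\to\infty.$$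
   Context: $\mathcal{S}_\alpha(\sigma)$, for $\alpha\in(0,2]$ and $\sigma\ge0$, is the symmetric $\alpha$-stable law with characteristic function $\theta\mapsto\exp(-|\sigma\theta|^\alpha)$, and $\mathcal{S}_\alpha=\mathcal{S}_\alpha(1)$. The law of a random variable $\xi$ is in the domain of normal attraction of $\mathcal{S}_\alpha$ if, for i.i.d. copies $\xi_1,\xi_2,\dots$ of $\xi$, $n^{-1/\alpha}\sum_{k=1}^n\xi_k$ converges in distribution to $\mathcal{S}_\alpha$ as $n\to\infty$ (normalization $a_n=n^{1/\alpha}$, centering $b_n=0$; this convention is used for $\alpha=2$ as well). For $0<\alpha\le 2$, $\|u\|_{\ell^\alpha}=\left(\sum_k|u_k|^\alpha\right)^{1/\alpha}$ (only a quasi-norm if $\alpha<1$), and $\ell^\alpha$ is the set of sequences for which it is finite. *)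

theory Defs
  imports "HOL-Probability.Probability"
begin

text \<open>
  The symmetric stable law with index \<open>\<alpha>\<close> and scale \<open>\<sigma>\<close> is given by its characteristic function.
  It is rendered as a predicate on laws, since the library contains no construction of it; the
  lemma \<open>sym_stable_law_unique\<close> shows that at most one law satisfies the predicate, so that
  ``\<open>\<exists>\<nu>. sym_stable_law \<alpha> \<sigma> \<nu> \<and> P \<nu>\<close>'' says that the law exists and has property \<open>P\<close>.
  For \<open>\<sigma> = 0\<close> it is the point mass at \<open>0\<close>, and for \<open>\<alpha> = 2\<close> the centred normal law with
  variance \<open>2 * \<sigma>\<^sup>2\<close>.
\<close>

definition sym_stable_law :: "real \<Rightarrow> real \<Rightarrow> real measure \<Rightarrow> bool" where
  "sym_stable_law \<alpha> \<sigma> \<nu> \<longleftrightarrow>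
     real_distribution \<nu> \<and>
     (\<forall>\<theta>. char \<nu> \<theta> = complex_of_real (exp (- (\<bar>\<sigma> * \<theta>\<bar> powr \<alpha>))))"

lemma sym_stable_law_unique:
  assumes "sym_stable_law \<alpha> \<sigma> \<nu>" "sym_stable_law \<alpha> \<sigma> \<nu>'"
  shows "\<nu> = \<nu>'"
  using assms by (intro Levy_uniqueness) (auto simp: sym_stable_law_def)

text \<open>
  The i.i.d. copies are realised as the coordinates on the infinite product of the law \<open>\<mu>\<close>;
  the lemma \<open>normal_attraction_iff\<close> shows that any other sequence of i.i.d. copies can be used.
\<close>

definition in_domain_of_normal_attraction :: "real \<Rightarrow> real measure \<Rightarrow> bool" where
  "in_domain_of_normal_attraction \<alpha> \<mu> \<longleftrightarrow>
     real_distribution \<mu> \<and>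
     (\<exists>\<nu>. sym_stable_law \<alpha> 1 \<nu> \<and>
        weak_conv_m
          (\<lambda>n. distr (\<Pi>\<^sub>M k\<in>(UNIV :: nat set). \<mu>) borel
                 (\<lambda>x. real n powr (- 1 / \<alpha>) * (\<Sum>k<n. x k)))
          \<nu>)"

lemma normal_attraction_iff:
  fixes X :: "nat \<Rightarrow> 'a \<Rightarrow> real"
  assumes "prob_space M"
    and indep: "prob_space.indep_vars M (\<lambda>_. borel) X UNIV"
    and law: "\<And>k. distr M borel (X k) = \<mu>"
  shows "in_domain_of_normal_attraction \<alpha> \<mu> \<longleftrightarrow>
     (\<exists>\<nu>. sym_stable_law \<alpha> 1 \<nu> \<and>
        weak_conv_m
          (\<lambda>n. distr M borel (\<lambda>\<omega>. real n powr (- 1 / \<alpha>) * (\<Sum>k<n. X k \<omega>))) \<nu>)"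
proof -
  interpret prob_space M by fact
  have X [measurable]: "X k \<in> borel_measurable M" for k
    using indep by (auto simp: indep_vars_def2)
  have mu: "real_distribution \<mu>"
    using real_distribution_distr[OF X[of 0]] law by simp
  have PiM: "(\<Pi>\<^sub>M k\<in>(UNIV :: nat set). \<mu>)
      = distr M (\<Pi>\<^sub>M k\<in>(UNIV :: nat set). borel) (\<lambda>\<omega>. \<lambda>k\<in>UNIV. X k \<omega>)"
    using iffD1[OF indep_vars_iff_distr_eq_PiM[of UNIV X "\<lambda>_. borel"] indep] law X by simp
  have "distr (\<Pi>\<^sub>M k\<in>(UNIV :: nat set). \<mu>) borel (\<lambda>x. real n powr (- 1 / \<alpha>) * (\<Sum>k<n. x k))
      = distr M borel (\<lambda>\<omega>. real n powr (- 1 / \<alpha>) * (\<Sum>k<n. X k \<omega>))" for n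
    unfolding PiM by (subst distr_distr) (auto simp: o_def)
  with mu show ?thesis
    by (simp add: in_domain_of_normal_attraction_def)
qed

definition in_lp :: "real \<Rightarrow> (nat \<Rightarrow> real) \<Rightarrow> bool" where
  "in_lp p u \<longleftrightarrow> summable (\<lambda>k. \<bar>u k\<bar> powr p)"

definition lp_norm :: "real \<Rightarrow> (nat \<Rightarrow> real) \<Rightarrow> real" where
  "lp_norm p u = (\<Sum>k. \<bar>u k\<bar> powr p) powr (1 / p)"

text \<open>The supremum is only meaningful for bounded sequences, in particular for those in \<open>\<ell>\<^sup>p\<close>.\<close>

definition linf_norm :: "(nat \<Rightarrow> real) \<Rightarrow> real" where
  "linf_norm u = (SUP k. \<bar>u k\<bar>)"

end

theory Submission
  imports Defs
begin

text \<open>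
  Let \<open>\<phi>\<close> be the characteristic function of \<open>\<mu>\<close>. Convergence in law is locally uniform
  convergence of characteristic functions, so \<open>\<phi>(\<theta> n\<^sup>-\<^sup>1\<^sup>/\<^sup>\<alpha>)\<^sup>n \<rightarrow> exp(-\<bar>\<theta>\<bar>\<^sup>\<alpha>)\<close> uniformly on compacts, and taking \<open>n\<close> of order \<open>\<bar>t\<bar>\<^sup>-\<^sup>\<alpha>\<close> gives
  \<open>\<phi>(t) = exp(-\<bar>t\<bar>\<^sup>\<alpha>) + o(\<bar>t\<bar>\<^sup>\<alpha>)\<close> at \<open>0\<close>. Since products of numbers of modulus at most \<open>1\<close> differ by at
  most the sum of the differences of the factors, \<open>\<Prod>\<^sub>k \<phi>(u\<^sub>k t)\<close> is close to \<open>exp(-\<bar>t\<bar>\<^sup>\<alpha> \<Sum>\<^sub>k \<bar>u\<^sub>k\<bar>\<^sup>\<alpha>)\<close>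
  as soon as \<open>sup\<^sub>k \<bar>u\<^sub>k\<bar>\<close> is small. Applied to the blocks \<open>m \<le> k < n\<close> of one series, this shows that
  the partial sums are Cauchy in probability, hence almost surely Cauchy by Ottaviani's
  inequality; applied to the whole series, it gives the limit law by Levy's continuity theorem.
\<close>

section \<open>Convergence in law and locally uniform convergence of characteristic
  functions\<close>

text \<open>Skorohod's coupling replaces weak convergence by pointwise convergence of
  \<open>Y' n\<close> to \<open>Y\<close> on one space. For |t| at most |T| the integrands differ by
  at most \<open>b n\<close>, which does not involve t, so dominated convergence controls all such t
  at once.\<close>

lemma uniform_limit_char:
  fixes \<mu> :: "nat \<Rightarrow> real measure" and T :: real
  assumes mu: "\<And>n. real_distribution (\<mu> n)" and nu: "real_distribution \<nu>"
    and conv: "weak_conv_m \<mu> \<nu>"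
  shows "uniform_limit {-T..T} (\<lambda>n. char (\<mu> n)) (char \<nu>) sequentially"
proof -
  obtain \<Omega> :: "real measure" and Y' Y where "prob_space \<Omega>"
    and Y' [measurable]: "\<And>n. Y' n \<in> borel_measurable \<Omega>" and dY': "\<And>n. distr \<Omega> borel (Y' n) = \<mu> n"
    and Y0: "Y \<in> measurable \<Omega> lborel" and dY: "distr \<Omega> borel Y = \<nu>"
    and lim: "\<And>x. x \<in> space \<Omega> \<Longrightarrow> (\<lambda>n. Y' n x) \<longlonglongrightarrow> Y x"
    using Skorohod[OF mu nu conv] by metis
  interpret prob_space \<Omega> by fact
  have Y [measurable]: "Y \<in> borel_measurable \<Omega>"
    using Y0 by simp
  define b where "b n x = min 2 (\<bar>T\<bar> * \<bar>Y' n x - Y x\<bar>)" for n x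
  have b_meas [measurable]: "b n \<in> borel_measurable \<Omega>" for n
    unfolding b_def by measurable
  have int_b: "integrable \<Omega> (b n)" for n
    by (rule integrable_const_bound[where B=2]) (auto simp: b_def)
  have lim_b: "(\<lambda>n. LINT x|\<Omega>. b n x) \<longlonglongrightarrow> (LINT x|\<Omega>. 0)"
  proof (rule integral_dominated_convergence[where w="\<lambda>_. 2"])
    have "(\<lambda>n. b n x) \<longlonglongrightarrow> min 2 (\<bar>T\<bar> * \<bar>Y x - Y x\<bar>)" if "x \<in> space \<Omega>" for x
      unfolding b_def by (intro tendsto_intros lim that)
    then show "AE x in \<Omega>. (\<lambda>n. b n x) \<longlonglongrightarrow> 0"
      by simp
  qed (auto simp: b_def)
  have bound: "cmod (char (\<mu> n) t - char \<nu> t) \<le> (LINT x|\<Omega>. b n x)" if "t \<in> {-T..T}" for n t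
  proof -
    have "char (\<mu> n) t - char \<nu> t = (CLINT x|\<Omega>. iexp (t * Y' n x) - iexp (t * Y x))"
      unfolding char_def dY[symmetric] dY'[symmetric]
      by (subst (1 2) integral_distr, measurable, subst Bochner_Integration.integral_diff)
        (auto intro!: integrable_const_bound[where B=1])
    also have "cmod \<dots> \<le> (LINT x|\<Omega>. cmod (iexp (t * Y' n x) - iexp (t * Y x)))"
      by (rule integral_norm_bound)
    also have "\<dots> \<le> (LINT x|\<Omega>. b n x)"
    proof (rule integral_mono)
      show "integrable \<Omega> (\<lambda>x. cmod (iexp (t * Y' n x) - iexp (t * Y x)))"
        by (rule integrable_const_bound[where B=2])
          (auto intro!: norm_triangle_le_diff)
      fix x
      have "cmod (iexp (t * Y' n x) - iexp (t * Y x)) \<le> 2"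
        using norm_triangle_ineq4[of "iexp (t * Y' n x)" "iexp (t * Y x)"] by simp
      \<comment> \<open>Factoring out the unimodular \<open>iexp (t * Y x)\<close> leaves |exp(ix) -
        1| \<le> |x|, the order 0 case of \<open>iexp_approx1\<close>.\<close>
      moreover have "iexp (t * Y' n x) - iexp (t * Y x)
          = iexp (t * Y x) * (iexp (t * (Y' n x - Y x)) - 1)"
        by (simp add: right_diff_distrib mult_exp_exp)
      then have "cmod (iexp (t * Y' n x) - iexp (t * Y x)) \<le> \<bar>t * (Y' n x - Y x)\<bar>"
        using iexp_approx1[of "t * (Y' n x - Y x)" 0] by (simp add: norm_mult del: of_real_mult of_real_diff)
      then have "cmod (iexp (t * Y' n x) - iexp (t * Y x)) \<le> \<bar>T\<bar> * \<bar>Y' n x - Y x\<bar>"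
        using that by (elim order_trans) (auto simp: abs_mult intro!: mult_right_mono)
      ultimately show "cmod (iexp (t * Y' n x) - iexp (t * Y x)) \<le> b n x"
        by (simp add: b_def)
    qed (rule int_b)
    finally show ?thesis .
  qed
  show ?thesis
    unfolding uniform_limit_iff
  proof safe
    fix e :: real assume "0 < e"
    with lim_b have "\<forall>\<^sub>F n in sequentially. (LINT x|\<Omega>. b n x) < e"
      by (intro order_tendstoD(2)[where y=0]) auto
    then show "\<forall>\<^sub>F n in sequentially. \<forall>t\<in>{-T..T}. dist (char (\<mu> n) t) (char \<nu> t) < e"
    proof eventually_elim
      case (elim n)
      then show ?case
        unfolding dist_norm using bound by (intro ballI le_less_trans[OF _ elim])
    qed
  qed
qed

section \<open>Expansion of a function at the origin from the limit of its rescaled powers\<close>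

lemma norm_exp_minus_one_le:
  fixes z :: complex
  assumes "norm z \<le> 1 / 2"
  shows "norm (exp z - 1) \<le> 2 * norm z"
proof -
  have "norm (exp z - 1) \<le> exp \<bar>Re z\<bar> * norm z"
    using Taylor_exp[of z 0] by simp
  also have "exp \<bar>Re z\<bar> \<le> exp (1 / 2)"
    using abs_Re_le_cmod[of z] assms by simp
  also have "\<dots> \<le> 2"
    by (rule exp_half_le2)
  finally show ?thesis by (simp add: mult_right_mono)
qed

text \<open>
  The logarithm of \<open>\<phi>\<close> is recovered from its powers without a branch error: along
  \<open>{-\<bar>t\<bar>..\<bar>t\<bar>}\<close> the continuous function \<open>h = n * (Ln \<phi> + \<bar>\<cdot>\<bar>\<^sup>\<alpha>)\<close> vanishes at \<open>0\<close>, and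
  \<open>exp h\<close> stays so close to \<open>1\<close> that the imaginary part of \<open>h\<close> never reaches \<open>\<plusminus>\<pi>/2\<close>.
\<close>

lemma stable_power_limit_imp_expansion:
  fixes \<phi> :: "real \<Rightarrow> complex" and \<alpha> \<epsilon> :: real
  assumes cont: "continuous_on UNIV \<phi>" and phi0: "\<phi> 0 = 1" and "0 < \<alpha>"
    and unif: "\<And>T. uniform_limit {-T..T} (\<lambda>n \<theta>. \<phi> (\<theta> * real n powr (- 1 / \<alpha>)) ^ n)
       (\<lambda>\<theta>. of_real (exp (- (\<bar>\<theta>\<bar> powr \<alpha>)))) sequentially"
    and "0 < \<epsilon>"
  shows "\<exists>\<delta>>0. \<forall>t. \<bar>t\<bar> < \<delta> \<longrightarrow> cmod (\<phi> t - of_real (exp (- (\<bar>t\<bar> powr \<alpha>)))) \<le> \<epsilon> * \<bar>t\<bar> powr \<alpha>"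
proof -
  \<comment> \<open>The first entry absorbs the factor 2 of \<open>norm_exp_minus_one_le\<close>;
    the second makes that lemma applicable to \<open>z\<close> below.\<close>
  define \<eta> where "\<eta> = min (\<epsilon> / 2) (1 / 2)"
  have "\<eta> > 0" using \<open>0 < \<epsilon>\<close> by (simp add: \<eta>_def)
  have "isCont Ln 1"
    by (intro continuous_intros) auto
  then obtain r0 where r0: "r0 > 0" "\<And>w. dist w 1 < r0 \<Longrightarrow> cmod (Ln w) < \<eta>"
    using \<open>\<eta> > 0\<close> unfolding continuous_at_eps_delta by (force simp: dist_norm)
  \<comment> \<open>Numbers within \<open>r0\<close> of 1 have logarithm below \<eta>; the cap at 1
    gives them positive real part, which is what bounds the imaginary part of
    \<open>h\<close>.\<close>
  define r where "r = min r0 1"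
  have r: "r > 0" "r \<le> 1" "\<And>w. dist w 1 < r \<Longrightarrow> cmod (Ln w) < \<eta>"
    using r0 by (auto simp: r_def)
  \<comment> \<open>The points \<theta> = s n^(1/\<alpha>) used below satisfy |\<theta>|^\<alpha> =
    |s|^\<alpha> n \<le> 2, hence lie in [-T, T]. Multiplying by exp(|s|^\<alpha> n) costs at most
    exp 2, hence the tolerance \<open>r / exp 2\<close>.\<close>
  define T :: real where "T = 2 powr (1 / \<alpha>)"
  from uniform_limitD[OF unif[of T], of "r / exp 2"] r(1)
  obtain N where N: "\<And>n \<theta>. n \<ge> N \<Longrightarrow> \<theta> \<in> {-T..T} \<Longrightarrow>
      cmod (\<phi> (\<theta> * real n powr (- 1 / \<alpha>)) ^ n - of_real (exp (- (\<bar>\<theta>\<bar> powr \<alpha>)))) < r / exp 2"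
    unfolding eventually_sequentially dist_norm using divide_pos_pos[OF r(1) exp_gt_zero] by blast
  from cont have "isCont \<phi> 0" by (simp add: continuous_on_eq_continuous_at)
  then obtain d1 where d1: "d1 > 0" "\<And>t. \<bar>t\<bar> < d1 \<Longrightarrow> dist (\<phi> t) 1 < 1"
    unfolding continuous_at_eps_delta phi0 by (metis zero_less_one diff_0_right dist_real_def)
  have Re_pos: "Re (\<phi> t) > 0" if "\<bar>t\<bar> < d1" for t
    using d1(2)[OF that] abs_Re_le_cmod[of "\<phi> t - 1"] by (simp add: dist_norm)
  \<comment> \<open>The entries serve in turn to keep \<phi> in the right half-plane, where
    \<open>Ln\<close> is continuous, to give \<open>a \<le> 1\<close>, and to force 1/a > N + 1, so
    that the \<open>n\<close> chosen below is at least \<open>N\<close>.\<close>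
  define \<delta> where "\<delta> = Min {d1, 1, (real N + 1) powr (- 1 / \<alpha>)}"
  show ?thesis
  proof (intro exI[of _ \<delta>] conjI allI impI)
    show "\<delta> > 0" using d1 by (simp add: \<delta>_def)
  next
    fix t assume "\<bar>t\<bar> < \<delta>"
    then have t: "\<bar>t\<bar> < d1" "\<bar>t\<bar> < 1" "\<bar>t\<bar> < (real N + 1) powr (- 1 / \<alpha>)" by (auto simp: \<delta>_def)
    show "cmod (\<phi> t - of_real (exp (- (\<bar>t\<bar> powr \<alpha>)))) \<le> \<epsilon> * \<bar>t\<bar> powr \<alpha>"
    proof (cases "t = 0")
      case True
      then show ?thesis by (simp add: phi0)
    next
      case False
      define a where "a = \<bar>t\<bar> powr \<alpha>"
      have a: "0 < a" "a \<le> 1"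
        using False t(2) \<open>0 < \<alpha>\<close> by (auto simp: a_def powr_le1)
      have "a < ((real N + 1) powr (- 1 / \<alpha>)) powr \<alpha>"
        unfolding a_def using t(3) False \<open>0 < \<alpha>\<close> by (intro powr_less_mono2) auto
      also have "\<dots> = 1 / (real N + 1)"
        using \<open>0 < \<alpha>\<close> by (subst powr_powr) (simp add: powr_minus_divide)
      finally have aN: "real N + 1 < 1 / a"
        using a by (simp add: field_simps)
      \<comment> \<open>With a \<le> 1 this puts n a between 1 and 2: the upper bound keeps \<theta>
        in the window [-T, T], the lower one finally trades 1/n for \<open>a\<close>.\<close>
      define n where "n = nat \<lceil>1 / a\<rceil>"
      have n1: "1 / a \<le> real n" "real n \<le> 1 / a + 1"
      proof -
        have "0 < \<lceil>1 / a\<rceil>" using a by simp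
        then have "real n = of_int \<lceil>1 / a\<rceil>" by (simp add: n_def)
        then show "1 / a \<le> real n" "real n \<le> 1 / a + 1" by linarith+
      qed
      have "n \<ge> N" "n > 0" using n1 aN by linarith+
      have an: "1 \<le> real n * a" "real n * a \<le> 2"
      proof -
        show "1 \<le> real n * a" using n1(1) a by (simp add: field_simps)
        have "real n * a \<le> (1 / a + 1) * a" using n1(2) a by (intro mult_right_mono) auto
        also have "\<dots> \<le> 2" using a by (simp add: field_simps)
        finally show "real n * a \<le> 2" .
      qed
      define h where "h s = of_nat n * (Ln (\<phi> s) + of_real (\<bar>s\<bar> powr \<alpha>))" for s
      have exp_h: "dist (exp (h s)) 1 < r" if "\<bar>s\<bar> \<le> \<bar>t\<bar>" for s
      proof -
        define \<theta> where "\<theta> = s * real n powr (1 / \<alpha>)"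
        have \<theta>_powr: "\<bar>\<theta>\<bar> powr \<alpha> = \<bar>s\<bar> powr \<alpha> * real n"
          using \<open>0 < \<alpha>\<close> by (simp add: \<theta>_def abs_mult powr_mult powr_powr)
        have le2: "\<bar>s\<bar> powr \<alpha> * real n \<le> 2"
        proof -
          have "\<bar>s\<bar> powr \<alpha> \<le> a"
            unfolding a_def using that \<open>0 < \<alpha>\<close> by (intro powr_mono2) auto
          then have "\<bar>s\<bar> powr \<alpha> * real n \<le> a * real n" by (intro mult_right_mono) auto
          with an show ?thesis by (simp add: mult.commute)
        qed
        have "\<bar>\<theta>\<bar> = (\<bar>\<theta>\<bar> powr \<alpha>) powr (1 / \<alpha>)"
          using \<open>0 < \<alpha>\<close> by (simp add: powr_powr)
        also have "\<dots> \<le> T"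
          unfolding T_def using le2 \<theta>_powr \<open>0 < \<alpha>\<close> by (intro powr_mono2) auto
        finally have "\<theta> \<in> {-T..T}" by auto
        moreover have "\<theta> * real n powr (- 1 / \<alpha>) = s"
          using \<open>n > 0\<close> by (simp add: \<theta>_def powr_minus field_simps)
        ultimately have *: "cmod (\<phi> s ^ n - of_real (exp (- (\<bar>s\<bar> powr \<alpha> * real n)))) < r / exp 2"
          using N[OF \<open>n \<ge> N\<close>, of \<theta>] by (simp add: \<theta>_powr)
        have "\<phi> s \<noteq> 0" using Re_pos[of s] that t by auto
        have "h s = of_nat n * Ln (\<phi> s) + of_real (\<bar>s\<bar> powr \<alpha> * real n)"
          by (simp add: h_def algebra_simps)
        then have exp_eq: "exp (h s) = \<phi> s ^ n * of_real (exp (\<bar>s\<bar> powr \<alpha> * real n))"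
          by (simp only: exp_add exp_of_nat_mult exp_of_real exp_Ln[OF \<open>\<phi> s \<noteq> 0\<close>])
        have "exp (h s) - 1 = of_real (exp (\<bar>s\<bar> powr \<alpha> * real n)) *
            (\<phi> s ^ n - of_real (exp (- (\<bar>s\<bar> powr \<alpha> * real n))))"
          unfolding exp_eq right_diff_distrib of_real_mult[symmetric] exp_minus_inverse
          by (simp add: mult.commute)
        then have "cmod (exp (h s) - 1) = exp (\<bar>s\<bar> powr \<alpha> * real n) *
            cmod (\<phi> s ^ n - of_real (exp (- (\<bar>s\<bar> powr \<alpha> * real n))))"
          by (simp add: norm_mult)
        also have "\<dots> \<le> exp 2 * cmod (\<phi> s ^ n - of_real (exp (- (\<bar>s\<bar> powr \<alpha> * real n))))"
          using le2 by (intro mult_right_mono) auto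
        also have "\<dots> < exp 2 * (r / exp 2)"
          using * by (intro mult_strict_left_mono) auto
        finally show ?thesis by (simp add: dist_norm)
      qed
      have cos_h: "cos (Im (h s)) > 0" if "\<bar>s\<bar> \<le> \<bar>t\<bar>" for s
      proof -
        have "Re (exp (h s)) > 0"
          using exp_h[OF that] r(2) abs_Re_le_cmod[of "exp (h s) - 1"] by (simp add: dist_norm)
        then show ?thesis by (simp add: Re_exp zero_less_mult_iff)
      qed
      have cont_h: "continuous_on {-\<bar>t\<bar>..\<bar>t\<bar>} (\<lambda>s. Im (h s))"
        unfolding h_def
      proof (intro continuous_on_Im continuous_on_mult continuous_on_add continuous_on_const
          continuous_on_Ln' continuous_on_of_real continuous_on_powr' continuous_on_rabs
          continuous_on_id continuous_on_subset[OF cont])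
        show "\<phi> s \<notin> \<real>\<^sub>\<le>\<^sub>0" if "s \<in> {-\<bar>t\<bar>..\<bar>t\<bar>}" for s
        proof -
          have "\<bar>s\<bar> \<le> \<bar>t\<bar>" using that by (intro abs_leI) auto
          then show ?thesis using Re_pos[of s] t(1) by (simp add: complex_nonpos_Reals_iff)
        qed
      qed (use \<open>0 < \<alpha>\<close> in auto)
      have h0: "Im (h 0) = 0" by (simp add: h_def phi0)
      have conn: "connected ((\<lambda>s. Im (h s)) ` {-\<bar>t\<bar>..\<bar>t\<bar>})"
        by (intro connected_continuous_image cont_h) auto
      have Im_in: "Im (h t) \<in> (\<lambda>s. Im (h s)) ` {-\<bar>t\<bar>..\<bar>t\<bar>}" "0 \<in> (\<lambda>s. Im (h s)) ` {-\<bar>t\<bar>..\<bar>t\<bar>}"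
        by (auto intro!: imageI) (use h0 in \<open>auto intro!: image_eqI[of 0 _ 0]\<close>)

      have "Im (h t) < pi / 2"
      proof (rule ccontr)
        assume "\<not> ?thesis"
        then have "pi / 2 \<in> (\<lambda>s. Im (h s)) ` {-\<bar>t\<bar>..\<bar>t\<bar>}"
          using connectedD_interval[OF conn Im_in(2,1)] by auto
        then obtain s where s: "s \<in> {-\<bar>t\<bar>..\<bar>t\<bar>}" "Im (h s) = pi / 2" by (metis imageE)
        then have "\<bar>s\<bar> \<le> \<bar>t\<bar>" by (intro abs_leI) auto
        from cos_h[OF this] show False unfolding s(2) by simp
      qed
      moreover have "Im (h t) > - (pi / 2)"
      proof (rule ccontr)
        assume "\<not> ?thesis"
        then have "- (pi / 2) \<in> (\<lambda>s. Im (h s)) ` {-\<bar>t\<bar>..\<bar>t\<bar>}"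
          using connectedD_interval[OF conn Im_in] by auto
        then obtain s where s: "s \<in> {-\<bar>t\<bar>..\<bar>t\<bar>}" "Im (h s) = - (pi / 2)" by (metis imageE)
        then have "\<bar>s\<bar> \<le> \<bar>t\<bar>" by (intro abs_leI) auto
        from cos_h[OF this] show False unfolding s(2) by simp
      qed
      ultimately have "Ln (exp (h t)) = h t"
        by (intro Ln_exp) auto
      with r(3)[OF exp_h[of t]] have h_small: "cmod (h t) < \<eta>" by simp
      \<comment> \<open>Here z = Ln (\<phi> t) + a, so exp z = \<phi>(t) exp(a). Dividing
        \<open>h t\<close> by n turns the bound \<eta> into \<eta>/n \<le> \<eta> a, which supplies
        the factor |t|^\<alpha> of the claim.\<close>
      define z where "z = h t / of_nat n"
      have "cmod z = cmod (h t) / real n" by (simp add: z_def norm_divide)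
      then have z: "cmod z \<le> \<eta> * (1 / real n)"
        using h_small \<open>n > 0\<close> by (simp add: field_simps)
      also have "\<dots> \<le> (1 / 2) * 1"
        using \<open>n > 0\<close> \<open>\<eta> > 0\<close> by (intro mult_mono) (auto simp: \<eta>_def)
      finally have z_half: "cmod z \<le> 1 / 2" by simp
      have "\<phi> t \<noteq> 0" using Re_pos[of t] t by auto
      then have exp_z: "exp z = \<phi> t * of_real (exp a)"
        using \<open>n > 0\<close> by (simp add: z_def h_def exp_add exp_of_real a_def)
      have "\<phi> t - of_real (exp (- a)) = of_real (exp (- a)) * (exp z - 1)"
        by (simp add: exp_z exp_minus field_simps)
      then have "cmod (\<phi> t - of_real (exp (- a))) = exp (- a) * cmod (exp z - 1)"
        by (simp add: norm_mult)
      also have "\<dots> \<le> 1 * (2 * cmod z)"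
        using a z_half by (intro mult_mono norm_exp_minus_one_le) auto
      also have "\<dots> \<le> 2 * (\<eta> * (1 / real n))" using z by simp
      also have "\<dots> \<le> 2 * (\<eta> * a)"
        using an \<open>n > 0\<close> \<open>\<eta> > 0\<close> by (intro mult_left_mono) (auto simp: field_simps)
      also have "\<dots> \<le> \<epsilon> * a" using a by (simp add: \<eta>_def min_def)
      finally show ?thesis by (simp add: a_def)
    qed
  qed
qed

section \<open>Almost sure convergence of series of independent variables\<close>

context prob_space begin

text \<open>Split according to the first \<open>k\<close> at which the partial sum exceeds 2a (event
  \<open>A k\<close>). The remaining block from k to n is independent of \<open>A k\<close> and is
  at most a in modulus (event \<open>B k\<close>) with probability at least 1 - \<eta>. On both
  events the full block exceeds a, so (1 - \<eta>) P(union of the \<open>A k\<close>) \<le>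
  \<eta>.\<close>

lemma ottaviani_inequality:
  fixes X :: "nat \<Rightarrow> 'a \<Rightarrow> real"
  assumes ind: "indep_vars (\<lambda>_. borel) X UNIV"
    and tail: "\<And>k. m \<le> k \<Longrightarrow> k \<le> n \<Longrightarrow> prob {\<omega> \<in> space M. \<bar>\<Sum>i=k..<n. X i \<omega>\<bar> > a} \<le> \<eta>"
    and "m \<le> n" "\<eta> < 1"
  shows "prob {\<omega> \<in> space M. \<exists>k\<in>{m..n}. \<bar>\<Sum>i=m..<k. X i \<omega>\<bar> > 2 * a} \<le> \<eta> / (1 - \<eta>)"
proof -
  have X [measurable]: "X k \<in> borel_measurable M" for k
    using ind by (auto simp: indep_vars_def2)
  \<comment> \<open>\<open>U k\<close> and \<open>V k\<close> are events on the product spaces over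
    disjoint index blocks; \<open>A k\<close> and \<open>B k\<close> are their preimages under the
    restricted families, which is the form in which \<open>indep_var_restrict\<close> yields
    independence.\<close>
  define U where "U k = {x \<in> space (\<Pi>\<^sub>M i\<in>{m..<k}. borel). \<bar>\<Sum>i=m..<k. x i\<bar> > 2 * a \<and>
      (\<forall>l\<in>{m..<k}. \<bar>\<Sum>i=m..<l. x i\<bar> \<le> 2 * a)}" for k :: nat
  define V where "V k = {x \<in> space (\<Pi>\<^sub>M i\<in>{k..<n}. borel). \<bar>\<Sum>i=k..<n. x i\<bar> \<le> a}" for k :: nat
  define A where "A k = {\<omega> \<in> space M. \<bar>\<Sum>i=m..<k. X i \<omega>\<bar> > 2 * a \<and>
      (\<forall>l\<in>{m..<k}. \<bar>\<Sum>i=m..<l. X i \<omega>\<bar> \<le> 2 * a)}" for k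
  define B where "B k = {\<omega> \<in> space M. \<bar>\<Sum>i=k..<n. X i \<omega>\<bar> \<le> a}" for k
  have ev [measurable]: "A k \<in> events" "B k \<in> events" for k
    unfolding A_def B_def by measurable
  have U [measurable]: "U k \<in> sets (\<Pi>\<^sub>M i\<in>{m..<k}. borel)" for k
    unfolding U_def
  proof (intro sets.sets_Collect_conj sets.sets_Collect_finite_All)
    have [measurable]: "(\<lambda>x. \<Sum>i=m..<l. x i) \<in> borel_measurable (\<Pi>\<^sub>M i\<in>{m..<k}. borel :: real measure)"
      if "l \<le> k" for l
    proof (rule borel_measurable_sum)
      fix i assume "i \<in> {m..<l}"
      with that have "i \<in> {m..<k}" by simp
      then show "(\<lambda>x. x i) \<in> borel_measurable (\<Pi>\<^sub>M i\<in>{m..<k}. borel)"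
        by (rule measurable_component_singleton)
    qed
    show "{x \<in> space (\<Pi>\<^sub>M i\<in>{m..<k}. borel). 2 * a < \<bar>\<Sum>i=m..<k. x i\<bar>} \<in> sets (\<Pi>\<^sub>M i\<in>{m..<k}. borel)"
      by measurable
    show "{x \<in> space (\<Pi>\<^sub>M i\<in>{m..<k}. borel). \<bar>\<Sum>i=m..<l. x i\<bar> \<le> 2 * a} \<in> sets (\<Pi>\<^sub>M i\<in>{m..<k}. borel)"
      if "l \<in> {m..<k}" for l
      by measurable (use that in simp)
  qed auto
  have V [measurable]: "V k \<in> sets (\<Pi>\<^sub>M i\<in>{k..<n}. borel)" for k
    unfolding V_def by measurable
  have indep_AB: "prob (A k \<inter> B k) = prob (A k) * prob (B k)" for k
  proof -
    have "indep_var (\<Pi>\<^sub>M i\<in>{m..<k}. borel) (\<lambda>\<omega>. \<lambda>i\<in>{m..<k}. X i \<omega>)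
        (\<Pi>\<^sub>M i\<in>{k..<n}. borel) (\<lambda>\<omega>. \<lambda>i\<in>{k..<n}. X i \<omega>)"
      by (rule indep_var_restrict[OF ind]) auto
    from indep_varD[OF this U V] show ?thesis
    proof (elim back_subst[of "\<lambda>p. p"], intro arg_cong2[where f="(=)"] arg_cong2[where f="(*)"] arg_cong[where f=prob])
    qed (auto simp: U_def V_def A_def B_def space_PiM)
  qed
  have disj: "disjoint_family_on A {m..n}"
    unfolding disjoint_family_on_def
  proof (intro ballI impI)
    fix k l assume "k \<in> {m..n}" "l \<in> {m..n}" "k \<noteq> l"
    then show "A k \<inter> A l = {}"
      by (cases "k < l") (force simp: A_def not_less)+
  qed
  have union: "{\<omega> \<in> space M. \<exists>k\<in>{m..n}. \<bar>\<Sum>i=m..<k. X i \<omega>\<bar> > 2 * a} = (\<Union>k\<in>{m..n}. A k)"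
  proof (intro set_eqI iffI)
    fix \<omega> assume "\<omega> \<in> {\<omega> \<in> space M. \<exists>k\<in>{m..n}. \<bar>\<Sum>i=m..<k. X i \<omega>\<bar> > 2 * a}"
    then have \<omega>: "\<omega> \<in> space M" "\<exists>k. k \<in> {m..n} \<and> \<bar>\<Sum>i=m..<k. X i \<omega>\<bar> > 2 * a" by auto
    from exists_least_iff[THEN iffD1, OF \<omega>(2)] obtain k where
      "k \<in> {m..n}" "\<bar>\<Sum>i=m..<k. X i \<omega>\<bar> > 2 * a"
      "\<And>l. l < k \<Longrightarrow> \<not> (l \<in> {m..n} \<and> \<bar>\<Sum>i=m..<l. X i \<omega>\<bar> > 2 * a)" by blast
    with \<omega>(1) show "\<omega> \<in> (\<Union>k\<in>{m..n}. A k)"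
      by (force simp: A_def not_less)
  qed (auto simp: A_def)
  have prob_B: "1 - \<eta> \<le> prob (B k)" if "k \<in> {m..n}" for k
  proof -
    have "{\<omega> \<in> space M. \<bar>\<Sum>i=k..<n. X i \<omega>\<bar> > a} = space M - B k" by (auto simp: B_def)
    then show ?thesis using tail[of k] that prob_compl[of "B k"] by simp
  qed
  have "(1 - \<eta>) * prob (\<Union>k\<in>{m..n}. A k) = (\<Sum>k=m..n. (1 - \<eta>) * prob (A k))"
    by (subst finite_measure_finite_Union[OF _ _ disj]) (auto simp: sum_distrib_left)
  also have "\<dots> \<le> (\<Sum>k=m..n. prob (A k \<inter> B k))"
    unfolding indep_AB mult.commute[of "1 - \<eta>"] using prob_B
    by (intro sum_mono mult_left_mono) auto
  also have "\<dots> = prob (\<Union>k\<in>{m..n}. A k \<inter> B k)"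
    using disj by (subst finite_measure_finite_Union) (auto simp: disjoint_family_on_def)
  also have "\<dots> \<le> prob {\<omega> \<in> space M. \<bar>\<Sum>i=m..<n. X i \<omega>\<bar> > a}"
  proof (rule finite_measure_mono)
    have "\<bar>\<Sum>i=m..<n. X i \<omega>\<bar> > a" if "k \<in> {m..n}" "\<omega> \<in> A k" "\<omega> \<in> B k" for k \<omega>
    proof -
      have "(\<Sum>i=m..<n. X i \<omega>) = (\<Sum>i=m..<k. X i \<omega>) + (\<Sum>i=k..<n. X i \<omega>)"
        using that by (simp add: sum.atLeastLessThan_concat)
      then show ?thesis using that by (auto simp: A_def B_def)
    qed
    then show "(\<Union>k\<in>{m..n}. A k \<inter> B k) \<subseteq> {\<omega> \<in> space M. \<bar>\<Sum>i=m..<n. X i \<omega>\<bar> > a}"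
      by (auto simp: A_def)
  qed measurable
  also have "\<dots> \<le> \<eta>" using tail[of m] \<open>m \<le> n\<close> by simp
  finally show ?thesis
    unfolding union using \<open>\<eta> < 1\<close> by (simp add: field_simps)
qed

text \<open>Ottaviani's inequality turns bounds on single blocks into a bound on all partial sums
  from \<open>N\<close> on, uniform in the right end. Hence the event \<open>F\<close> of exceeding
  2a after every starting index is null. Letting a run through 1/(p+1) leaves countably many null
  sets, outside of which the partial sums are Cauchy.\<close>

lemma AE_summable_if_Cauchy_in_prob:
  fixes X :: "nat \<Rightarrow> 'a \<Rightarrow> real"
  assumes ind: "indep_vars (\<lambda>_. borel) X UNIV"
    and cauchy: "\<And>a \<eta>. 0 < a \<Longrightarrow> 0 < \<eta> \<Longrightarrow>
      \<exists>N. \<forall>m n. N \<le> m \<longrightarrow> m \<le> n \<longrightarrow> prob {\<omega> \<in> space M. \<bar>\<Sum>i=m..<n. X i \<omega>\<bar> > a} \<le> \<eta>"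
  shows "AE \<omega> in M. summable (\<lambda>i. X i \<omega>)"
proof -
  have X [measurable]: "X k \<in> borel_measurable M" for k
    using ind by (auto simp: indep_vars_def2)
  have osc: "AE \<omega> in M. \<exists>N. \<forall>k\<ge>N. \<bar>\<Sum>i=N..<k. X i \<omega>\<bar> \<le> 2 * a" if "a > 0" for a
  proof -
    define E where "E m = {\<omega> \<in> space M. \<exists>k\<in>{m..}. \<bar>\<Sum>i=m..<k. X i \<omega>\<bar> > 2 * a}" for m
    define F where "F = {\<omega> \<in> space M. \<forall>m. \<exists>k\<in>{m..}. \<bar>\<Sum>i=m..<k. X i \<omega>\<bar> > 2 * a}"
    have [measurable]: "E m \<in> events" "F \<in> events" for m
      unfolding E_def F_def by measurable
    have "prob F \<le> e" if "0 < e" for e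
    proof -
      \<comment> \<open>Since 1 - \<eta> \<ge> 1/2, the Ottaviani bound \<eta>/(1 - \<eta>) is at
        most 2 \<eta> \<le> e.\<close>
      define \<eta> where "\<eta> = min (e / 2) (1 / 2)"
      have eta: "0 < \<eta>" "\<eta> < 1" "\<eta> / (1 - \<eta>) \<le> e"
        using \<open>0 < e\<close> by (auto simp: \<eta>_def min_def field_simps)
      obtain N where N: "\<And>m n. N \<le> m \<Longrightarrow> m \<le> n \<Longrightarrow>
          prob {\<omega> \<in> space M. \<bar>\<Sum>i=m..<n. X i \<omega>\<bar> > a} \<le> \<eta>"
        using cauchy[OF \<open>a > 0\<close> eta(1)] by blast
      define G where "G n = {\<omega> \<in> space M. \<exists>k\<in>{N..n}. \<bar>\<Sum>i=N..<k. X i \<omega>\<bar> > 2 * a}" for n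
      have G [measurable]: "G n \<in> events" for n
        unfolding G_def by measurable
      have "prob (G n) \<le> e" if "N \<le> n" for n
        unfolding G_def using ottaviani_inequality[OF ind N that eta(2)] eta(3) by simp
      \<comment> \<open>The events \<open>G n\<close> increase, so the bound passes to their union,
        the event that some partial sum started at \<open>N\<close> exceeds 2a. It contains
        \<open>F\<close>, which asks this of every starting index.\<close>
      moreover have "(\<lambda>n. prob (G n)) \<longlonglongrightarrow> prob (\<Union>n. G n)"
        by (rule finite_Lim_measure_incseq) (force simp: incseq_def G_def)+
      ultimately have "prob (\<Union>n. G n) \<le> e"
        by (intro LIMSEQ_le_const2[of _ _ e]) auto
      moreover have "F \<subseteq> (\<Union>n. G n)"
        by (force simp: F_def G_def)
      ultimately show ?thesis
        using finite_measure_mono[of F "\<Union>n. G n"] by auto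
    qed
    then have "prob F = 0"
      using measure_nonneg[of M F] field_le_epsilon[of "prob F" 0] by (intro antisym) auto
    then have "F \<in> null_sets M"
      by (auto simp: emeasure_eq_measure null_sets_def)
    then show ?thesis
      by (rule AE_I') (force simp: F_def not_le)
  qed
  have "AE \<omega> in M. \<forall>p. \<exists>N. \<forall>k\<ge>N. \<bar>\<Sum>i=N..<k. X i \<omega>\<bar> \<le> 2 * (1 / real (Suc p))"
    unfolding AE_all_countable by (intro allI osc) simp
  then show ?thesis
  proof eventually_elim
    case (elim \<omega>)
    show ?case
      unfolding summable_Cauchy
    proof (intro allI impI)
      fix e :: real assume "0 < e"
      \<comment> \<open>A block from m to n is the difference of two sums started at N, each at most
        2/(p+1) < e/2.\<close>
      then obtain p where p: "1 / real (Suc p) < e / 4"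
        using nat_approx_posE[of "e / 4"] by auto
      from elim obtain N where N: "\<And>k. k \<ge> N \<Longrightarrow> \<bar>\<Sum>i=N..<k. X i \<omega>\<bar> \<le> 2 * (1 / real (Suc p))"
        by blast
      have "norm (\<Sum>i=m..<n. X i \<omega>) < e" if "m \<ge> N" for m n
      proof (cases "m \<le> n")
        case True
        then have "(\<Sum>i=m..<n. X i \<omega>) = (\<Sum>i=N..<n. X i \<omega>) - (\<Sum>i=N..<m. X i \<omega>)"
          using that by (simp add: sum_diff_nat_ivl)
        moreover have "\<bar>\<Sum>i=N..<n. X i \<omega>\<bar> < e / 2" "\<bar>\<Sum>i=N..<m. X i \<omega>\<bar> < e / 2"
          using N[of n] N[of m] that True p by linarith+
        ultimately show ?thesis
          unfolding real_norm_def by linarith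
      qed (use \<open>0 < e\<close> in simp)
      then show "\<exists>N. \<forall>m\<ge>N. \<forall>n. norm (\<Sum>i=m..<n. X i \<omega>) < e" by blast
    qed
  qed
qed

text \<open>Otherwise there are violating pairs \<open>m N\<close>, \<open>n N\<close> beyond every
  N. The characteristic functions of the corresponding variables tend to 1, so by Levy's theorem
  their laws converge to the point mass at 0. As a > 0, the point 0 is off the frontier of the set
  |x| > a, whose probabilities therefore tend to 0, a contradiction.\<close>

lemma Cauchy_in_prob_if_char:
  fixes S :: "nat \<Rightarrow> nat \<Rightarrow> 'a \<Rightarrow> real"
  assumes S [measurable]: "\<And>m n. S m n \<in> borel_measurable M"
    and char: "\<And>t e. 0 < e \<Longrightarrow>
      \<exists>N. \<forall>m n. N \<le> m \<longrightarrow> m \<le> n \<longrightarrow> cmod (char (distr M borel (S m n)) t - 1) \<le> e"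
    and "0 < a" "0 < \<eta>"
  shows "\<exists>N. \<forall>m n. N \<le> m \<longrightarrow> m \<le> n \<longrightarrow> prob {\<omega> \<in> space M. \<bar>S m n \<omega>\<bar> > a} \<le> \<eta>"
proof (rule ccontr)
  assume "\<not> ?thesis"
  then have "\<forall>N. \<exists>m n. N \<le> m \<and> m \<le> n \<and> prob {\<omega> \<in> space M. \<bar>S m n \<omega>\<bar> > a} > \<eta>"
    by (auto simp: not_le)
  then obtain m n where mn: "\<And>N. N \<le> m N" "\<And>N. m N \<le> n N"
    "\<And>N. prob {\<omega> \<in> space M. \<bar>S (m N) (n N) \<omega>\<bar> > a} > \<eta>"
    by metis
  define \<mu> where "\<mu> N = distr M borel (S (m N) (n N))" for N
  have mu: "real_distribution (\<mu> N)" for N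
    unfolding \<mu>_def by (rule real_distribution_distr) simp
  have nu: "real_distribution (return borel (0::real))"
    by (auto simp: real_distribution_def real_distribution_axioms_def intro: prob_space_return)
  have "(\<lambda>N. char (\<mu> N) t) \<longlonglongrightarrow> char (return borel 0) t" for t
  proof -
    have "(\<lambda>N. char (\<mu> N) t) \<longlonglongrightarrow> 1"
      unfolding LIMSEQ_iff
    proof (intro allI impI)
      fix e :: real assume "0 < e"
      then obtain N where "\<And>m n. N \<le> m \<Longrightarrow> m \<le> n \<Longrightarrow> cmod (char (distr M borel (S m n)) t - 1) \<le> e / 2"
        using char[of "e / 2" t] by auto
      with mn \<open>0 < e\<close> show "\<exists>N. \<forall>k\<ge>N. cmod (char (\<mu> k) t - 1) < e"
        unfolding \<mu>_def by (intro exI[of _ N]) (smt (verit) field_sum_of_halves order_trans)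
    qed
    then show ?thesis
      by (simp add: char_def integral_return)
  qed
  then have conv: "weak_conv_m \<mu> (return borel 0)"
    by (intro levy_continuity mu nu)
  have "(\<lambda>N. measure (\<mu> N) {x. \<bar>x\<bar> > a}) \<longlonglongrightarrow> measure (return borel 0) {x. \<bar>x\<bar> > a}"
  proof (rule weak_conv_imp_continuity_set_conv[OF mu nu conv])
    have "open {x::real. \<bar>x\<bar> > a}"
      by (intro open_Collect_less continuous_intros)
    moreover have "closure {x::real. \<bar>x\<bar> > a} \<subseteq> {x. \<bar>x\<bar> \<ge> a}"
      by (intro closure_minimal closed_Collect_le continuous_intros) auto
    ultimately have "0 \<notin> frontier {x::real. \<bar>x\<bar> > a}"
      using \<open>0 < a\<close> by (auto simp: frontier_def)
    then show "emeasure (return borel 0) (frontier {x::real. \<bar>x\<bar> > a}) = 0"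
      by simp
  qed measurable
  moreover have "measure (return borel (0::real)) {x. \<bar>x\<bar> > a} = 0"
    using \<open>0 < a\<close> by (simp add: measure_return)
  ultimately have "(\<lambda>N. measure (\<mu> N) {x. \<bar>x\<bar> > a}) \<longlonglongrightarrow> 0" by simp
  then have "\<forall>\<^sub>F N in sequentially. measure (\<mu> N) {x. \<bar>x\<bar> > a} < \<eta>"
    using \<open>0 < \<eta>\<close> by (rule order_tendstoD(2))
  moreover have "measure (\<mu> N) {x. \<bar>x\<bar> > a} = prob {\<omega> \<in> space M. \<bar>S (m N) (n N) \<omega>\<bar> > a}" for N
    unfolding \<mu>_def by (subst measure_distr) (auto intro!: arg_cong[where f=prob])
  ultimately show False
    using mn(3) unfolding eventually_sequentially by (metis less_asym order_refl)
qed

end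

section \<open>Columns of the array, linear combinations and sequence norms\<close>

text \<open>Each series runs through one column. A finite set J of row indices embeds into the pairs
  as J x {j}, where the product formula of the array applies.\<close>

lemma (in prob_space) indep_vars_column:
  assumes "indep_vars (\<lambda>_. N) (\<lambda>(k, j). X k j) (UNIV :: ('i \<times> 'j) set)"
  shows "indep_vars (\<lambda>_. N) (\<lambda>k. X k j) UNIV"
proof -
  have X: "X k j \<in> measurable M N" for k j
    using assms by (auto simp: indep_vars_def2)
  have ind: "indep_sets (\<lambda>p. {(case p of (k, j) \<Rightarrow> X k j) -` A \<inter> space M |A. A \<in> sets N}) (UNIV :: ('i \<times> 'j) set)"
    using assms by (auto simp: indep_vars_def2)
  have "indep_sets (\<lambda>k. {X k j -` A \<inter> space M |A. A \<in> sets N}) UNIV"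
  proof (rule indep_setsI)
    show "{X k j -` A \<inter> space M |A. A \<in> sets N} \<subseteq> events" for k
      using measurable_sets[OF X] by auto
  next
    fix A J assume J: "J \<noteq> {}" "finite (J :: 'i set)"
      and A: "\<forall>k\<in>J. A k \<in> {X k j -` A \<inter> space M |A. A \<in> sets N}"
    have inj: "inj_on (\<lambda>k. (k, j)) J" by (auto simp: inj_on_def)
    have "prob (\<Inter>p\<in>(\<lambda>k. (k, j)) ` J. A (fst p)) = (\<Prod>p\<in>(\<lambda>k. (k, j)) ` J. prob (A (fst p)))"
      using J A by (intro indep_setsD[OF ind]) auto
    then show "prob (\<Inter>k\<in>J. A k) = (\<Prod>k\<in>J. prob (A k))"
      by (simp add: prod.reindex[OF inj] o_def)
  qed
  with X show ?thesis by (simp add: indep_vars_def2)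
qed

lemma char_distr_cmult:
  assumes "X \<in> borel_measurable M"
  shows "char (distr M borel (\<lambda>\<omega>. c * X \<omega>)) t = char (distr M borel X) (c * t)"
  using assms by (simp add: char_def integral_distr ac_simps)

lemma (in prob_space) char_distr_linear_combination:
  assumes ind: "indep_vars (\<lambda>_. borel) X A" and law: "\<And>k. k \<in> A \<Longrightarrow> distr M borel (X k) = \<mu>"
  shows "char (distr M borel (\<lambda>\<omega>. \<Sum>k\<in>A. c k * X k \<omega>)) t = (\<Prod>k\<in>A. char \<mu> (c k * t))"
proof -
  have "indep_vars (\<lambda>_. borel) (\<lambda>k \<omega>. c k * X k \<omega>) A"
    by (rule indep_vars_compose2[OF ind]) simp
  moreover have "X k \<in> borel_measurable M" if "k \<in> A" for k
    using ind that by (auto simp: indep_vars_def2)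
  ultimately show ?thesis
    by (simp add: char_distr_sum char_distr_cmult law cong: prod.cong)
qed

text \<open>A real supremum is an upper bound only for a bounded set; the finite \<ell>^p quantity
  supplies the bound.\<close>

lemma abs_le_linf_norm:
  assumes "0 < p" "in_lp p u"
  shows "\<bar>u k\<bar> \<le> linf_norm u"
  unfolding linf_norm_def
proof (rule cSUP_upper)
  have "\<bar>u k\<bar> \<le> (\<Sum>k. \<bar>u k\<bar> powr p) powr (1 / p)" for k
  proof -
    have "\<bar>u k\<bar> powr p \<le> (\<Sum>k. \<bar>u k\<bar> powr p)"
      using sum_le_suminf[of "\<lambda>k. \<bar>u k\<bar> powr p" "{k}"] assms by (simp add: in_lp_def)
    then have "(\<bar>u k\<bar> powr p) powr (1 / p) \<le> (\<Sum>k. \<bar>u k\<bar> powr p) powr (1 / p)"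
      using assms by (intro powr_mono2) auto
    then show ?thesis using assms by (simp add: powr_powr)
  qed
  then show "bdd_above (range (\<lambda>k. \<bar>u k\<bar>))" by (rule bdd_aboveI2)
qed simp

section \<open>Normal attraction in terms of characteristic functions\<close>

text \<open>On the infinite product the normalized sum of n coordinates has characteristic function
  \<open>char \<mu> (t * real n powr (- 1 / \<alpha>)) ^ n\<close>, so the hypothesis becomes the
  uniform limit of rescaled powers treated above.\<close>

lemma normal_attraction_char_expansion:
  assumes "0 < \<alpha>" and dom: "in_domain_of_normal_attraction \<alpha> \<mu>" and "0 < \<epsilon>"
  shows "\<exists>\<delta>>0. \<forall>t. \<bar>t\<bar> < \<delta> \<longrightarrow> cmod (char \<mu> t - of_real (exp (- (\<bar>t\<bar> powr \<alpha>)))) \<le> \<epsilon> * \<bar>t\<bar> powr \<alpha>"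
proof -
  from dom obtain \<nu> where "real_distribution \<mu>" and nu: "sym_stable_law \<alpha> 1 \<nu>"
    and conv: "weak_conv_m (\<lambda>n. distr (\<Pi>\<^sub>M k\<in>(UNIV :: nat set). \<mu>) borel
                 (\<lambda>x. real n powr (- 1 / \<alpha>) * (\<Sum>k<n. x k))) \<nu>"
    by (auto simp: in_domain_of_normal_attraction_def)
  interpret real_distribution \<mu> by fact
  interpret P: product_prob_space "\<lambda>_. \<mu>" "UNIV :: nat set" ..
  have law: "distr (\<Pi>\<^sub>M k\<in>(UNIV :: nat set). \<mu>) borel (\<lambda>x. x k) = \<mu>" for k
    using P.PiM_component[of k] by (simp cong: distr_cong)
  \<comment> \<open>Independence of the coordinates amounts to the coordinate map, which is the
    identity, having the product measure as its law; \<mu> and \<open>borel\<close> have the same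
    measurable sets.\<close>
  have ind: "P.indep_vars (\<lambda>_. borel) (\<lambda>k x. x k) UNIV"
  proof (subst P.indep_vars_iff_distr_eq_PiM)
    have "distr (\<Pi>\<^sub>M k\<in>(UNIV :: nat set). \<mu>) (\<Pi>\<^sub>M k\<in>(UNIV :: nat set). borel) (\<lambda>x. \<lambda>k\<in>UNIV. x k)
        = (\<Pi>\<^sub>M k\<in>UNIV. \<mu>)"
      by (rule distr_id2[THEN trans[rotated]]) (auto intro!: distr_cong sets_PiM_cong)
    then show "distr (\<Pi>\<^sub>M k\<in>(UNIV :: nat set). \<mu>) (\<Pi>\<^sub>M k\<in>(UNIV :: nat set). borel) (\<lambda>x. \<lambda>k\<in>UNIV. x k)
        = (\<Pi>\<^sub>M k\<in>UNIV. distr (\<Pi>\<^sub>M k\<in>(UNIV :: nat set). \<mu>) borel (\<lambda>x. x k))"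
      by (simp add: law)
  qed auto
  have char_eq: "char (distr (\<Pi>\<^sub>M k\<in>(UNIV :: nat set). \<mu>) borel
                 (\<lambda>x. real n powr (- 1 / \<alpha>) * (\<Sum>k<n. x k))) t
      = char \<mu> (t * real n powr (- 1 / \<alpha>)) ^ n" for n t
    using P.char_distr_linear_combination[OF P.indep_vars_subset[OF ind subset_UNIV[of "{..<n}"]] law,
      of "\<lambda>_. real n powr (- 1 / \<alpha>)"]
    by (simp add: sum_distrib_left mult.commute[of t])
  have char_nu: "char \<nu> = (\<lambda>t. of_real (exp (- (\<bar>t\<bar> powr \<alpha>))))"
    using nu by (auto simp: sym_stable_law_def)
  show ?thesis
  proof (rule stable_power_limit_imp_expansion[OF _ _ \<open>0 < \<alpha>\<close> _ \<open>0 < \<epsilon>\<close>])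
    show "continuous_on UNIV (char \<mu>)"
      using isCont_char by (simp add: continuous_at_imp_continuous_on)
    show "char \<mu> 0 = 1" by (rule char_zero)
    fix T
    show "uniform_limit {-T..T} (\<lambda>n \<theta>. char \<mu> (\<theta> * real n powr (- 1 / \<alpha>)) ^ n)
       (\<lambda>\<theta>. of_real (exp (- (\<bar>\<theta>\<bar> powr \<alpha>)))) sequentially"
      unfolding char_nu[symmetric] char_eq[symmetric]
      using nu by (intro uniform_limit_char conv P.real_distribution_distr)
        (auto simp: sym_stable_law_def)
  qed
qed

text \<open>This provides the existence of the limit law: normal attraction supplies the law of
  scale 1, and dilation by \<sigma> multiplies the argument of the characteristic function by
  \<sigma>. The case \<sigma> = 0 gives the point mass at 0.\<close>

lemma sym_stable_law_scale:
  assumes nu: "sym_stable_law \<alpha> 1 \<nu>" and "0 \<le> \<sigma>"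
  shows "sym_stable_law \<alpha> \<sigma> (distr \<nu> borel (\<lambda>x. \<sigma> * x))"
proof -
  interpret real_distribution \<nu> using nu by (simp add: sym_stable_law_def)
  have "distr \<nu> borel (\<lambda>x. x) = \<nu>"
    by (rule distr_id2) simp
  then show ?thesis
    using nu char_distr_cmult[of "\<lambda>x. x" \<nu> \<sigma>]
    by (auto simp: sym_stable_law_def intro!: real_distribution_distr)
qed

text \<open>The exponential factorizes over \<open>I\<close>, all factors on both sides have modulus
  at most 1, and so the errors of the factors add up. For infinite \<open>I\<close> the conventions
  for sums and products make both sides 0.\<close>

lemma norm_prod_char_minus_exp_le:
  assumes "real_distribution \<mu>" and "0 \<le> \<epsilon>"
    and bound: "\<And>t. \<bar>t\<bar> < \<delta> \<Longrightarrow> cmod (char \<mu> t - of_real (exp (- (\<bar>t\<bar> powr \<alpha>)))) \<le> \<epsilon> * \<bar>t\<bar> powr \<alpha>"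
    and small: "\<And>k. k \<in> I \<Longrightarrow> \<bar>c k * t\<bar> < \<delta>"
  shows "cmod ((\<Prod>k\<in>I. char \<mu> (c k * t)) - of_real (exp (- (\<bar>t\<bar> powr \<alpha> * (\<Sum>k\<in>I. \<bar>c k\<bar> powr \<alpha>)))))
      \<le> \<epsilon> * (\<bar>t\<bar> powr \<alpha> * (\<Sum>k\<in>I. \<bar>c k\<bar> powr \<alpha>))"
proof (cases "finite I")
  case True
  interpret real_distribution \<mu> by fact
  have powr_eq: "\<bar>c k * t\<bar> powr \<alpha> = \<bar>t\<bar> powr \<alpha> * \<bar>c k\<bar> powr \<alpha>" for k
    by (simp add: abs_mult powr_mult)
  have "exp (- (\<bar>t\<bar> powr \<alpha> * (\<Sum>k\<in>I. \<bar>c k\<bar> powr \<alpha>))) = (\<Prod>k\<in>I. exp (- (\<bar>c k * t\<bar> powr \<alpha>)))"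
    by (simp add: exp_sum[OF True, symmetric] sum_negf sum_distrib_left powr_eq)
  then have "cmod ((\<Prod>k\<in>I. char \<mu> (c k * t)) - of_real (exp (- (\<bar>t\<bar> powr \<alpha> * (\<Sum>k\<in>I. \<bar>c k\<bar> powr \<alpha>)))))
      = cmod ((\<Prod>k\<in>I. char \<mu> (c k * t)) - (\<Prod>k\<in>I. of_real (exp (- (\<bar>c k * t\<bar> powr \<alpha>)))))"
    by simp
  also have "\<dots> \<le> (\<Sum>k\<in>I. cmod (char \<mu> (c k * t) - of_real (exp (- (\<bar>c k * t\<bar> powr \<alpha>)))))"
    by (intro norm_prod_diff cmod_char_le_1) simp
  also have "\<dots> \<le> (\<Sum>k\<in>I. \<epsilon> * \<bar>c k * t\<bar> powr \<alpha>)"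
    by (intro sum_mono bound small)
  finally show ?thesis
    by (simp add: powr_eq sum_distrib_left)
qed simp

section \<open>Convergence and characteristic function of a single series\<close>

text \<open>The column index is frozen: \<open>X\<close> stands for one column of the array and
  \<open>c\<close> for its vector of weights.\<close>

locale stable_combination = prob_space M for M :: "'a measure" +
  fixes \<alpha> :: real and \<mu> :: "real measure" and X :: "nat \<Rightarrow> 'a \<Rightarrow> real" and c :: "nat \<Rightarrow> real"
  assumes alpha: "0 < \<alpha>"
    and ind: "indep_vars (\<lambda>_. borel) X UNIV"
    and law: "\<And>k. distr M borel (X k) = \<mu>"
    and dom: "in_domain_of_normal_attraction \<alpha> \<mu>"
    and lp: "in_lp \<alpha> c"
begin

lemma X_measurable [measurable]: "X k \<in> borel_measurable M"
  using ind by (auto simp: indep_vars_def2)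

lemma real_distribution_mu: "real_distribution \<mu>"
  using dom by (simp add: in_domain_of_normal_attraction_def)

lemma char_sum: "char (distr M borel (\<lambda>\<omega>. \<Sum>k\<in>I. c k * X k \<omega>)) t = (\<Prod>k\<in>I. char \<mu> (c k * t))"
  by (rule char_distr_linear_combination[OF indep_vars_subset[OF ind subset_UNIV] law])

text \<open>The expansion with \<epsilon> = 1 is enough. The weights tend to 0, so late blocks only
  see arguments below \<delta>. With A the sum of |c i t|^\<alpha> over such a block, its
  characteristic function is within A of exp(-A), which is within A of 1, and A < e/2 for late
  blocks by summability.\<close>

lemma AE_summable: "AE \<omega> in M. summable (\<lambda>k. c k * X k \<omega>)"
proof (rule AE_summable_if_Cauchy_in_prob[OF _ Cauchy_in_prob_if_char])
  show "indep_vars (\<lambda>_. borel) (\<lambda>k \<omega>. c k * X k \<omega>) UNIV"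
    by (rule indep_vars_compose2[OF ind]) simp
next
  fix t e :: real assume "0 < e"
  obtain \<delta> where \<delta>: "\<delta> > 0" "\<And>s. \<bar>s\<bar> < \<delta> \<Longrightarrow>
      cmod (char \<mu> s - of_real (exp (- (\<bar>s\<bar> powr \<alpha>)))) \<le> 1 * \<bar>s\<bar> powr \<alpha>"
    using normal_attraction_char_expansion[OF alpha dom zero_less_one] by blast
  define a where "a k = \<bar>t\<bar> powr \<alpha> * \<bar>c k\<bar> powr \<alpha>" for k
  have a_eq: "a k = \<bar>c k * t\<bar> powr \<alpha>" for k
    by (simp add: a_def abs_mult powr_mult)
  have "summable a"
    unfolding a_def using lp by (intro summable_mult) (simp add: in_lp_def)
  from summable_LIMSEQ_zero[OF this] have "\<forall>\<^sub>F k in sequentially. a k < \<delta> powr \<alpha>"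
    using \<delta>(1) by (intro order_tendstoD(2)) auto
  then obtain N1 where N1: "\<And>k. k \<ge> N1 \<Longrightarrow> a k < \<delta> powr \<alpha>"
    by (auto simp: eventually_sequentially)
  have small: "\<bar>c k * t\<bar> < \<delta>" if "k \<ge> N1" for k
  proof (rule ccontr)
    assume "\<not> ?thesis"
    then have "\<delta> powr \<alpha> \<le> a k"
      unfolding a_eq using \<delta>(1) alpha by (intro powr_mono2) auto
    with N1[OF that] show False by simp
  qed
  obtain N2 where N2: "\<And>m n. m \<ge> N2 \<Longrightarrow> norm (sum a {m..<n}) < e / 2"
    using \<open>summable a\<close> \<open>0 < e\<close> unfolding summable_Cauchy by (meson half_gt_zero)
  show "\<exists>N. \<forall>m n. N \<le> m \<longrightarrow> m \<le> n \<longrightarrow>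
      cmod (char (distr M borel (\<lambda>\<omega>. \<Sum>i=m..<n. c i * X i \<omega>)) t - 1) \<le> e"
  proof (intro exI[of _ "max N1 N2"] allI impI)
    fix m n assume "max N1 N2 \<le> m"
    then have m: "N1 \<le> m" "N2 \<le> m" by auto
    let ?A = "sum a {m..<n}"
    have A: "0 \<le> ?A" "?A < e / 2" "\<bar>t\<bar> powr \<alpha> * (\<Sum>i=m..<n. \<bar>c i\<bar> powr \<alpha>) = ?A"
      using N2[OF m(2), of n] by (auto simp: a_def sum_nonneg sum_distrib_left)
    have "cmod ((\<Prod>i=m..<n. char \<mu> (c i * t)) - of_real (exp (- ?A))) \<le> 1 * ?A"
      using norm_prod_char_minus_exp_le[OF real_distribution_mu _ \<delta>(2), where I="{m..<n}" and c=c and t=t] small m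
      by (simp add: A(3))
    moreover have "cmod (of_real (exp (- ?A)) - 1) \<le> ?A"
    proof -
      have "cmod (of_real (exp (- ?A)) - 1) = \<bar>exp (- ?A) - 1\<bar>"
        by (metis norm_of_real of_real_1 of_real_diff)
      also have "\<dots> \<le> ?A"
        using A(1) exp_ge_add_one_self[of "- ?A"] exp_le_one_iff[of "- ?A"]
        unfolding abs_le_iff by linarith
      finally show ?thesis .
    qed
    ultimately have "cmod ((\<Prod>i=m..<n. char \<mu> (c i * t)) - 1) \<le> ?A + ?A"
      using norm_triangle_ineq[of "(\<Prod>i=m..<n. char \<mu> (c i * t)) - of_real (exp (- ?A))"
        "of_real (exp (- ?A)) - 1"] by simp
    with A(2) show "cmod (char (distr M borel (\<lambda>\<omega>. \<Sum>i=m..<n. c i * X i \<omega>)) t - 1) \<le> e"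
      by (simp add: char_sum)
  qed
qed measurable

text \<open>The bound for finite products passes to the limit. The supremum norm keeps all arguments
  below \<delta> simultaneously, and almost sure convergence of the series gives convergence of the
  characteristic functions of the partial sums by dominated convergence.\<close>

lemma norm_char_series_minus_exp_le:
  assumes "0 \<le> \<epsilon>"
    and "\<And>s. \<bar>s\<bar> < \<delta> \<Longrightarrow> cmod (char \<mu> s - of_real (exp (- (\<bar>s\<bar> powr \<alpha>)))) \<le> \<epsilon> * \<bar>s\<bar> powr \<alpha>"
    and small: "linf_norm c * \<bar>t\<bar> < \<delta>"
  shows "cmod (char (distr M borel (\<lambda>\<omega>. \<Sum>k. c k * X k \<omega>)) t
      - of_real (exp (- (\<bar>t\<bar> powr \<alpha> * (\<Sum>k. \<bar>c k\<bar> powr \<alpha>)))))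
      \<le> \<epsilon> * (\<bar>t\<bar> powr \<alpha> * (\<Sum>k. \<bar>c k\<bar> powr \<alpha>))"
proof (rule LIMSEQ_le)
  have le: "\<bar>c k * t\<bar> < \<delta>" for k
    using mult_right_mono[OF abs_le_linf_norm[OF alpha lp, of k], of "\<bar>t\<bar>"] small
    by (simp add: abs_mult)
  have lim: "(\<lambda>n. \<Sum>k<n. \<bar>c k\<bar> powr \<alpha>) \<longlonglongrightarrow> (\<Sum>k. \<bar>c k\<bar> powr \<alpha>)"
    using lp by (intro summable_LIMSEQ) (simp add: in_lp_def)
  have "(\<lambda>n. char (distr M borel (\<lambda>\<omega>. \<Sum>k<n. c k * X k \<omega>)) t) \<longlonglongrightarrow>
      char (distr M borel (\<lambda>\<omega>. \<Sum>k. c k * X k \<omega>)) t"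
  proof -
    have "(\<lambda>n. CLINT \<omega>|M. iexp (t * (\<Sum>k<n. c k * X k \<omega>)))
        \<longlonglongrightarrow> (CLINT \<omega>|M. iexp (t * (\<Sum>k. c k * X k \<omega>)))"
    proof (rule integral_dominated_convergence[where w="\<lambda>_. 1"])
      show "AE \<omega> in M. (\<lambda>n. iexp (t * (\<Sum>k<n. c k * X k \<omega>))) \<longlonglongrightarrow> iexp (t * (\<Sum>k. c k * X k \<omega>))"
        using AE_summable
        by eventually_elim (intro tendsto_intros summable_LIMSEQ)
    qed auto
    then show ?thesis
      by (simp add: char_def integral_distr)
  qed
  with lim show "(\<lambda>n. cmod ((\<Prod>k<n. char \<mu> (c k * t))
      - of_real (exp (- (\<bar>t\<bar> powr \<alpha> * (\<Sum>k<n. \<bar>c k\<bar> powr \<alpha>)))))) \<longlonglongrightarrow>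
      cmod (char (distr M borel (\<lambda>\<omega>. \<Sum>k. c k * X k \<omega>)) t
      - of_real (exp (- (\<bar>t\<bar> powr \<alpha> * (\<Sum>k. \<bar>c k\<bar> powr \<alpha>)))))"
    unfolding char_sum by (intro tendsto_intros)
  show "(\<lambda>n. \<epsilon> * (\<bar>t\<bar> powr \<alpha> * (\<Sum>k<n. \<bar>c k\<bar> powr \<alpha>))) \<longlonglongrightarrow>
      \<epsilon> * (\<bar>t\<bar> powr \<alpha> * (\<Sum>k. \<bar>c k\<bar> powr \<alpha>))"
    by (intro tendsto_intros lim)
  show "\<exists>N. \<forall>n\<ge>N. cmod ((\<Prod>k<n. char \<mu> (c k * t))
      - of_real (exp (- (\<bar>t\<bar> powr \<alpha> * (\<Sum>k<n. \<bar>c k\<bar> powr \<alpha>)))))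
      \<le> \<epsilon> * (\<bar>t\<bar> powr \<alpha> * (\<Sum>k<n. \<bar>c k\<bar> powr \<alpha>))"
    using assms(1,2) le
    by (intro exI[of _ 0] allI impI norm_prod_char_minus_exp_le[where \<delta>=\<delta>] real_distribution_mu) auto
qed

end

section \<open>Limit law along the sequence of series\<close>

theorem theorem2p2:
  fixes M :: "'a measure"
    and \<alpha> \<sigma> :: real
    and \<mu> :: "real measure"
    and \<xi> :: "nat \<Rightarrow> nat \<Rightarrow> 'a \<Rightarrow> real"
    and u :: "nat \<Rightarrow> nat \<Rightarrow> real"
  assumes "prob_space M"
    and "0 < \<alpha>" "\<alpha> \<le> 2" "0 \<le> \<sigma>"
    and "prob_space.indep_vars M (\<lambda>_. borel) (\<lambda>(k, j). \<xi> k j) UNIV"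
    and "\<And>k j. distr M borel (\<xi> k j) = \<mu>"
    and "in_domain_of_normal_attraction \<alpha> \<mu>"
    and "\<And>j. in_lp \<alpha> (u j)"
    and "(\<lambda>j. lp_norm \<alpha> (u j)) \<longlonglongrightarrow> \<sigma>"
    and "(\<lambda>j. linf_norm (u j)) \<longlonglongrightarrow> 0"
  shows "(\<forall>j. AE \<omega> in M. summable (\<lambda>k. u j k * \<xi> k j \<omega>)) \<and>
    (\<exists>\<nu>. sym_stable_law \<alpha> \<sigma> \<nu> \<and>
       weak_conv_m (\<lambda>j. distr M borel (\<lambda>\<omega>. \<Sum>k. u j k * \<xi> k j \<omega>)) \<nu>)"
proof -
  interpret prob_space M by fact
  have comb: "stable_combination M \<alpha> \<mu> (\<lambda>k. \<xi> k j) (u j)" for j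
    using assms indep_vars_column[OF assms(5)]
    by (simp add: stable_combination_def stable_combination_axioms_def)
  have meas [measurable]: "\<xi> k j \<in> borel_measurable M" for k j
    using stable_combination.X_measurable[OF comb] .
  from assms(7) obtain \<nu>1 where "sym_stable_law \<alpha> 1 \<nu>1"
    by (auto simp: in_domain_of_normal_attraction_def)
  from sym_stable_law_scale[OF this \<open>0 \<le> \<sigma>\<close>] obtain \<nu> where nu: "sym_stable_law \<alpha> \<sigma> \<nu>"
    by blast
  define A where "A j = (\<Sum>k. \<bar>u j k\<bar> powr \<alpha>)" for j
  \<comment> \<open>The outer power 1/\<alpha> of the norm is undone. The form
    \<open>tendsto_powr'\<close> also covers the limit \<sigma> = 0, since the norms are nonnegative
    and \<alpha> > 0.\<close>
  have A_lim: "A \<longlonglongrightarrow> \<sigma> powr \<alpha>"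
  proof -
    have "(\<lambda>j. lp_norm \<alpha> (u j) powr \<alpha>) \<longlonglongrightarrow> \<sigma> powr \<alpha>"
      using assms(2,4,9) by (intro tendsto_powr') (auto simp: lp_norm_def)
    moreover have "lp_norm \<alpha> (u j) powr \<alpha> = A j" for j
      using assms(2,8) by (simp add: lp_norm_def A_def powr_powr in_lp_def suminf_nonneg)
    ultimately show ?thesis by simp
  qed
  have "weak_conv_m (\<lambda>j. distr M borel (\<lambda>\<omega>. \<Sum>k. u j k * \<xi> k j \<omega>)) \<nu>"
  proof (rule levy_continuity)
    show "real_distribution \<nu>" using nu by (simp add: sym_stable_law_def)
    show "real_distribution (distr M borel (\<lambda>\<omega>. \<Sum>k. u j k * \<xi> k j \<omega>))" for j
      by (intro real_distribution_distr) simp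
    fix t
    let ?\<phi> = "\<lambda>j. char (distr M borel (\<lambda>\<omega>. \<Sum>k. u j k * \<xi> k j \<omega>)) t"
    let ?B = "\<lambda>j. \<bar>t\<bar> powr \<alpha> * A j"
    have B_lim: "?B \<longlonglongrightarrow> \<bar>t\<bar> powr \<alpha> * \<sigma> powr \<alpha>"
      by (intro tendsto_intros A_lim)
    have "(\<lambda>j. ?\<phi> j - of_real (exp (- ?B j))) \<longlonglongrightarrow> 0"
      unfolding tendsto_iff dist_norm diff_0_right
    proof (intro allI impI)
      fix e :: real assume "0 < e"
      \<comment> \<open>Eventually \<open>?B j\<close> is below its limit plus 1, so the error
        \<epsilon> \<open>?B j\<close> stays below \<epsilon> b = e. Adding 1 also keeps b positive
        when t or \<sigma> is 0.\<close>
      define b where "b = \<bar>t\<bar> powr \<alpha> * \<sigma> powr \<alpha> + 1"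
      have "b > 0" by (simp add: b_def add_nonneg_pos)
      define \<epsilon> where "\<epsilon> = e / b"
      have "\<epsilon> > 0" using \<open>0 < e\<close> \<open>b > 0\<close> by (simp add: \<epsilon>_def)
      obtain \<delta> where \<delta>: "\<delta> > 0" "\<And>s. \<bar>s\<bar> < \<delta> \<Longrightarrow>
          cmod (char \<mu> s - of_real (exp (- (\<bar>s\<bar> powr \<alpha>)))) \<le> \<epsilon> * \<bar>s\<bar> powr \<alpha>"
        using normal_attraction_char_expansion[OF assms(2,7) \<open>\<epsilon> > 0\<close>] by blast
      have "(\<lambda>j. linf_norm (u j) * \<bar>t\<bar>) \<longlonglongrightarrow> 0"
        using assms(10) by (rule tendsto_mult_left_zero)
      then have "\<forall>\<^sub>F j in sequentially. linf_norm (u j) * \<bar>t\<bar> < \<delta>"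
        using \<delta>(1) by (rule order_tendstoD(2))
      moreover have "\<forall>\<^sub>F j in sequentially. ?B j < b"
        by (rule order_tendstoD(2)[OF B_lim]) (simp add: b_def)
      ultimately show "\<forall>\<^sub>F j in sequentially. cmod (?\<phi> j - of_real (exp (- ?B j))) < e"
      proof eventually_elim
        case (elim j)
        have "cmod (?\<phi> j - of_real (exp (- ?B j))) \<le> \<epsilon> * ?B j"
          unfolding A_def
          by (rule stable_combination.norm_char_series_minus_exp_le[OF comb _ \<delta>(2) elim(1)])
            (use \<open>\<epsilon> > 0\<close> in auto)
        also have "\<dots> < \<epsilon> * b"
          using elim(2) \<open>\<epsilon> > 0\<close> by (rule mult_strict_left_mono)
        also have "\<dots> = e" using \<open>b > 0\<close> by (simp add: \<epsilon>_def)
        finally show ?case .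
      qed
    qed
    moreover have "(\<lambda>j. of_real (exp (- ?B j)) :: complex) \<longlonglongrightarrow> of_real (exp (- (\<bar>t\<bar> powr \<alpha> * \<sigma> powr \<alpha>)))"
      by (intro tendsto_intros B_lim)
    ultimately have "?\<phi> \<longlonglongrightarrow> of_real (exp (- (\<bar>t\<bar> powr \<alpha> * \<sigma> powr \<alpha>)))"
      using tendsto_add by fastforce
    then show "?\<phi> \<longlonglongrightarrow> char \<nu> t"
      using nu \<open>0 \<le> \<sigma>\<close> by (simp add: sym_stable_law_def abs_mult powr_mult mult.commute)
  qed
  with nu show ?thesis
    using stable_combination.AE_summable[OF comb] by blast
qed

end
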